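(* Let $Q\in\mathrm{Gr}(k,n)$ and $X\in\mathbb{T}_Q\mathrm{Gr}(k,n)$ with \[ Q=VI_{k,n-k}V^{\mathsf T},\qquad X=V\begin{bmatrix}0 & B \\ B^{\mathsf T} & 0\end{bmatrix}V^{\mathsf T}, \] where $V\in\mathrm{O}(n)$ and $B\in\mathbb{R}^{k\times(n-k)}$. The geodesic $\gamma$ in $\mathrm{Gr}(k,n)$ emanating from $Q$ in the direction $X$ (i.e. with $\gamma(0)=Q$, $\dot\gamma(0)=X$) is given by \[ \gamma(t)=V\exp\left(\frac t2\begin{bmatrix}0 & -B \\ B^{\mathsf T} & 0\end{bmatrix}\right)I_{k,n-k}\exp\left(\frac t2\begin{bmatrix}0 & B \\ -B^{\mathsf T} & 0\end{bmatrix}\right)V^{\mathsf T}. \] The differential equation for $\gamma$ (the geodesic equation for curves in $\mathrm{Gr}(k,n)$, with initial conditions) is \[ \gamma(t)^{\mathsf T}\ddot\gamma(t)-\ddot\gamma(t)^{\mathsf T}\gamma(t)=0,\qquad\gamma(0)=Q,\qquad\dot\gamma(0)=X. \]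
   Context: For $k\in\{1,\dots,n\}$, $\mathrm{Gr}(k,n)=\{Q\in\mathrm{O}(n):Q^{\mathsf T}=Q,\ \operatorname{tr}(Q)=2k-n\}$, an embedded submanifold of $\mathbb{R}^{n\times n}$, equipped with the Riemannian metric $\langle X,Y\rangle_Q=\operatorname{tr}(XY)$ for $X,Y\in\mathbb{T}_Q\mathrm{Gr}(k,n)$. $I_{k,n-k}=\operatorname{diag}(I_k,-I_{n-k})$. Every $Q\in\mathrm{Gr}(k,n)$ can be written $Q=VI_{k,n-k}V^{\mathsf T}$ with $V\in\mathrm{O}(n)$, and $\mathbb{T}_Q\mathrm{Gr}(k,n)=\bigl\{V\begin{bmatrix}0 & B \\ B^{\mathsf T} & 0\end{bmatrix}V^{\mathsf T}:B\in\mathbb{R}^{k\times(n-k)}\bigr\}$. $\exp$ is the matrix exponential. *)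

theory Defs
  imports "HOL-Analysis.Analysis"
begin

section \<open>Geodesics of submanifolds of a Euclidean space\<close>

definition velocity :: "(real \<Rightarrow> 'a::real_normed_vector) \<Rightarrow> real \<Rightarrow> 'a" where
  "velocity c = (\<lambda>t. vector_derivative c (at t))"

definition smooth_curve_on :: "real set \<Rightarrow> (real \<Rightarrow> 'a::real_normed_vector) \<Rightarrow> bool" where
  "smooth_curve_on J c \<longleftrightarrow> (\<forall>m. \<forall>t\<in>J. (velocity ^^ m) c differentiable (at t))"

definition tangent_space :: "'a::euclidean_space set \<Rightarrow> 'a \<Rightarrow> 'a set" where
  "tangent_space M p = {v. \<exists>c e. e > 0 \<and> smooth_curve_on {-e<..<e} c \<and> c ` {-e<..<e} \<subseteq> M
                              \<and> c 0 = p \<and> velocity c 0 = v}"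

text \<open>
  Covariant derivative along a curve \<open>c\<close> in \<open>M\<close> of a vector field \<open>W\<close> along \<open>c\<close>, for the
  Riemannian metric on \<open>M\<close> induced by the ambient inner product. The Levi-Civita connection of the
  induced metric is the tangential part of the ambient derivative. Since \<open>tangent_space M p\<close> is a
  linear subspace when \<open>M\<close> is an embedded submanifold, \<open>closest_point\<close> is the orthogonal
  projection onto it.
\<close>
definition covariant_deriv ::
    "'a::euclidean_space set \<Rightarrow> (real \<Rightarrow> 'a) \<Rightarrow> (real \<Rightarrow> 'a) \<Rightarrow> real \<Rightarrow> 'a" where
  "covariant_deriv M c W t = closest_point (tangent_space M (c t)) (velocity W t)"

definition geodesic_on :: "'a::euclidean_space set \<Rightarrow> real set \<Rightarrow> (real \<Rightarrow> 'a) \<Rightarrow> bool" where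
  "geodesic_on M J c \<longleftrightarrow> open J \<and> is_interval J \<and> smooth_curve_on J c \<and> c ` J \<subseteq> M \<and>
     (\<forall>t\<in>J. covariant_deriv M c (velocity c) t = 0)"

section \<open>Matrices\<close>

primrec mpow :: "real^'n^'n \<Rightarrow> nat \<Rightarrow> real^'n^'n" where
  "mpow A 0 = mat 1"
| "mpow A (Suc m) = A ** mpow A m"

text \<open>The library's \<open>exp\<close> does not apply to square matrices, and \<open>*\<close> and \<open>^\<close> act
  componentwise on them.\<close>
definition mexp :: "real^'n^'n \<Rightarrow> real^'n^'n" where
  "mexp A = (\<Sum>m. (1 / fact m) *\<^sub>R mpow A m)"

text \<open>The 0-based position of an index, so that the rows and columns of a matrix of type
  \<open>real^'n^'n\<close> are numbered \<open>0, \<dots>, CARD('n) - 1\<close>.\<close>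
definition pos :: "'n::{finite,linorder} \<Rightarrow> nat" where
  "pos i = card {j. j < i}"

text \<open>The matrix with blocks \<open>A\<close> (\<open>k \<times> k\<close>), \<open>B\<close> (\<open>k \<times> (n - k)\<close>), \<open>C\<close> (\<open>(n - k) \<times> k\<close>) and
  \<open>D\<close> (\<open>(n - k) \<times> (n - k)\<close>), where \<open>n = CARD('n)\<close>. Blocks are functions of 0-based row and column
  numbers, as \<open>n - k\<close> may be 0; their values outside the stated sizes are not used.\<close>
definition block_mat :: "nat \<Rightarrow> (nat \<Rightarrow> nat \<Rightarrow> real) \<Rightarrow> (nat \<Rightarrow> nat \<Rightarrow> real) \<Rightarrow>
    (nat \<Rightarrow> nat \<Rightarrow> real) \<Rightarrow> (nat \<Rightarrow> nat \<Rightarrow> real) \<Rightarrow> real^('n::{finite,linorder})^('n::{finite,linorder})" where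
  "block_mat k A B C D = (\<chi> i j.
     if pos i < k
     then (if pos j < k then A (pos i) (pos j) else B (pos i) (pos j - k))
     else (if pos j < k then C (pos i - k) (pos j) else D (pos i - k) (pos j - k)))"

definition zero_block :: "nat \<Rightarrow> nat \<Rightarrow> real" where
  "zero_block = (\<lambda>i j. 0)"

definition id_block :: "nat \<Rightarrow> nat \<Rightarrow> real" where
  "id_block = (\<lambda>i j. if i = j then 1 else 0)"

definition neg_block :: "(nat \<Rightarrow> nat \<Rightarrow> real) \<Rightarrow> nat \<Rightarrow> nat \<Rightarrow> real" where
  "neg_block B = (\<lambda>i j. - B i j)"

definition transp_block :: "(nat \<Rightarrow> nat \<Rightarrow> real) \<Rightarrow> nat \<Rightarrow> nat \<Rightarrow> real" where
  "transp_block B = (\<lambda>i j. B j i)"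

definition I_sig :: "nat \<Rightarrow> real^('n::{finite,linorder})^('n::{finite,linorder})" where
  "I_sig k = block_mat k id_block zero_block zero_block (neg_block id_block)"

section \<open>The Grassmannian\<close>

definition Gr :: "nat \<Rightarrow> (real^'n^'n) set" where
  "Gr k = {Q. orthogonal_matrix Q \<and> transpose Q = Q \<and> trace Q = 2 * real k - real CARD('n)}"

text \<open>The metric induced on \<open>Gr k\<close> by the inner product of \<open>real^'n^'n\<close> is
  \<open>trace (X ** Y)\<close>.\<close>

lemma inner_matrix_eq_trace: "X \<bullet> Y = trace (transpose X ** Y)" for X Y :: "real^'n^'n"
proof -
  have "X \<bullet> Y = (\<Sum>i\<in>UNIV. \<Sum>j\<in>UNIV. X$i$j * Y$i$j)"
    by (simp add: inner_vec_def)
  also have "\<dots> = (\<Sum>j\<in>UNIV. \<Sum>i\<in>UNIV. X$i$j * Y$i$j)"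
    by (rule sum.swap)
  finally show ?thesis
    by (simp add: trace_def matrix_matrix_mult_def transpose_def)
qed

lemma tangent_Gr_symmetric:
  fixes Q X :: "real^'n^'n"
  assumes "X \<in> tangent_space (Gr k) Q"
  shows "transpose X = X"
proof -
  obtain c e where e: "e > 0" and sm: "smooth_curve_on {-e<..<e} c"
    and Gr: "c ` {-e<..<e} \<subseteq> Gr k" and X: "velocity c 0 = X"
    using assms unfolding tangent_space_def by auto
  have "(velocity ^^ 0) c differentiable (at 0)"
    using sm e unfolding smooth_curve_on_def by (metis greaterThanLessThan_iff neg_less_0_iff_less)
  then have d: "(c has_vector_derivative X) (at 0)"
    using X by (auto simp: velocity_def vector_derivative_works)
  have "bounded_linear (transpose :: real^'n^'n \<Rightarrow> real^'n^'n)"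
    by (intro linear_conv_bounded_linear[THEN iffD1] linearI)
       (simp_all add: transpose_def vec_eq_iff)
  then have dT: "((\<lambda>t. transpose (c t)) has_vector_derivative transpose X) (at 0)"
    using d by (rule bounded_linear.has_vector_derivative)
  have sym: "transpose (c t) = c t" if "t \<in> {-e<..<e}" for t
    using Gr that unfolding Gr_def by blast
  have "((\<lambda>t. transpose (c t)) has_vector_derivative X) (at 0)"
    by (rule has_vector_derivative_transform_within_open[OF d, of "{-e<..<e}"])
       (use e in \<open>simp_all add: sym\<close>)
  then show ?thesis
    using dT vector_derivative_unique_at by blast
qed

lemma metric_Gr:
  fixes Q X Y :: "real^'n^'n"
  assumes "X \<in> tangent_space (Gr k) Q"
  shows "X \<bullet> Y = trace (X ** Y)"
  using tangent_Gr_symmetric[OF assms] by (simp add: inner_matrix_eq_trace)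

end

theory Submission
  imports Defs
begin

text \<open>
  The tangent space at \<open>P\<close> consists of the symmetric \<open>X\<close> with \<open>P X + X P = 0\<close>: the curve
  \<open>P exp(t P X)\<close> realises such an \<open>X\<close>. The orthogonal projection of a symmetric \<open>W\<close> onto it is
  \<open>(W - P W P) / 2\<close>, so a curve \<open>c\<close> is a geodesic iff \<open>c\<close> and \<open>c''\<close> commute. Then \<open>c c'\<close> is a
  constant \<open>K = Q X\<close>, and because \<open>c\<^sup>2 = 1\<close> the geodesic equation reduces to the linear equation
  \<open>c' = c K\<close>, whose only solution is \<open>Q exp(t K)\<close>. As \<open>I_sig k\<close> anticommutes with the
  off-diagonal block matrices, this is the stated curve.
\<close>

section \<open>Matrix calculus\<close>

interpretation matmul: bounded_bilinear
  "(**) :: real^'n^'n \<Rightarrow> real^'n^'n \<Rightarrow> real^'n^'n"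
proof -
  have "bilinear ((**) :: real^'n^'n \<Rightarrow> real^'n^'n \<Rightarrow> real^'n^'n)"
    unfolding bilinear_def
    by (auto intro!: linearI simp: matrix_matrix_mult_def vec_eq_iff algebra_simps
        sum.distrib sum_distrib_left)
  then show "bounded_bilinear ((**) :: real^'n^'n \<Rightarrow> real^'n^'n \<Rightarrow> real^'n^'n)"
    by (simp add: bilinear_conv_bounded_bilinear)
qed

lemma bounded_linear_transpose: "bounded_linear (transpose :: real^'n^'n \<Rightarrow> real^'n^'n)"
  by (intro linear_conv_bounded_linear[THEN iffD1] linearI)
     (simp_all add: transpose_def vec_eq_iff)

lemmas transpose_linear =
  linear_add[OF bounded_linear.linear[OF bounded_linear_transpose]]
  linear_diff[OF bounded_linear.linear[OF bounded_linear_transpose]]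
  linear_scale[OF bounded_linear.linear[OF bounded_linear_transpose]]
  linear_0[OF bounded_linear.linear[OF bounded_linear_transpose]]

section \<open>Powers and the exponential series\<close>

lemma mpow_commute: "mpow A m ** A = A ** mpow A m"
  by (induction m) (simp_all add: matrix_mul_assoc[symmetric])

lemma transpose_mpow: "transpose (mpow A m) = mpow (transpose A) m"
  by (induction m) (simp_all add: matrix_transpose_mul mpow_commute)

lemma mpow_scaleR: "mpow (t *\<^sub>R A) m = t ^ m *\<^sub>R mpow A m"
  by (induction m) (simp_all add: matmul.scaleR_left matmul.scaleR_right mult.commute)

lemma mpow_intertwine:
  assumes "M ** A = B ** M"
  shows "M ** mpow A m = mpow B m ** M"
proof (induction m)
  case (Suc m)
  have "M ** mpow A (Suc m) = B ** (M ** mpow A m)"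
    by (simp add: matrix_mul_assoc assms)
  then show ?case
    by (simp add: Suc matrix_mul_assoc)
qed simp

text \<open>A crude bound is enough for convergence: each further factor of \<open>A\<close>
  contributes at most one absolute row sum, and this is at most the sum over all entries.\<close>

lemma mpow_entry_bound:
  fixes A :: "real^'n^'n"
  shows "\<bar>mpow A m $ i $ j\<bar> \<le> (\<Sum>i\<in>UNIV. \<Sum>j\<in>UNIV. \<bar>A $ i $ j\<bar>) ^ m"
proof (induction m arbitrary: i j)
  case 0
  then show ?case by (simp add: mat_def)
next
  case (Suc m)
  let ?S = "\<Sum>i\<in>UNIV. \<Sum>j\<in>UNIV. \<bar>A $ i $ j\<bar>"
  have "\<bar>mpow A (Suc m) $ i $ j\<bar> \<le> (\<Sum>l\<in>UNIV. \<bar>A $ i $ l * mpow A m $ l $ j\<bar>)"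
    by (simp add: matrix_matrix_mult_def sum_abs)
  also have "\<dots> \<le> (\<Sum>l\<in>UNIV. \<bar>A $ i $ l\<bar> * ?S ^ m)"
    by (intro sum_mono) (simp add: abs_mult Suc mult_left_mono)
  also have "\<dots> = (\<Sum>l\<in>UNIV. \<bar>A $ i $ l\<bar>) * ?S ^ m"
    by (simp add: sum_distrib_right)
  also have "\<dots> \<le> ?S * ?S ^ m"
    by (intro mult_right_mono member_le_sum[of i UNIV "\<lambda>i. \<Sum>j\<in>UNIV. \<bar>A $ i $ j\<bar>"])
       (auto intro!: sum_nonneg zero_le_power)
  finally show ?case by simp
qed

text \<open>The series is dominated by the scalar exponential series at
  \<open>?S * \<bar>t\<bar>\<close>. Writing it as a power series in \<open>t\<close> prepares
  termwise differentiation.\<close>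

lemma summable_mexp_entry:
  fixes A :: "real^'n^'n"
  shows "summable (\<lambda>m. mpow A m $ i $ j / fact m * t ^ m)"
proof (rule summable_comparison_test')
  let ?S = "\<Sum>i\<in>UNIV. \<Sum>j\<in>UNIV. \<bar>A $ i $ j\<bar>"
  show "summable (\<lambda>m. (?S * \<bar>t\<bar>) ^ m /\<^sub>R fact m)"
    by (rule summable_exp_generic)
  show "norm (mpow A m $ i $ j / fact m * t ^ m) \<le> (?S * \<bar>t\<bar>) ^ m /\<^sub>R fact m" if "m \<ge> 0" for m
    using mult_right_mono[OF mpow_entry_bound[of A m i j], of "\<bar>t\<bar> ^ m / fact m"]
    by (simp add: abs_mult power_mult_distrib power_abs field_simps)
qed

text \<open>\<open>mexp\<close> is a \<open>suminf\<close>, which has the intended value only once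
  convergence is known. Entrywise convergence suffices; the factor \<open>1 ^ m\<close> in the limit
  comes from taking the power series of an entry at \<open>t = 1\<close>.\<close>

lemma mexp_sums:
  fixes A :: "real^'n^'n"
  shows "(\<lambda>m. (1 / fact m) *\<^sub>R mpow A m) sums mexp A"
proof -
  have "(\<lambda>m. (1 / fact m) *\<^sub>R mpow A m) sums (\<chi> i j. \<Sum>m. mpow A m $ i $ j / fact m * 1 ^ m)"
    unfolding sums_def
  proof (intro vec_tendstoI)
    fix i j :: 'n
    show "(\<lambda>N. (\<Sum>m<N. (1 / fact m) *\<^sub>R mpow A m) $ i $ j)
        \<longlonglongrightarrow> (\<chi> i j. \<Sum>m. mpow A m $ i $ j / fact m * 1 ^ m) $ i $ j"
      using summable_sums[OF summable_mexp_entry[of A i j 1]]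
      by (simp add: sums_def)
  qed
  then show ?thesis
    unfolding mexp_def by (intro summable_sums sums_summable)
qed

lemma mexp_scaleR_entry: "mexp (t *\<^sub>R A) $ i $ j = (\<Sum>m. mpow A m $ i $ j / fact m * t ^ m)"
proof -
  have "(\<lambda>m. ((1 / fact m) *\<^sub>R mpow (t *\<^sub>R A) m) $ i $ j) sums (mexp (t *\<^sub>R A) $ i $ j)"
    by (intro bounded_linear.sums[OF bounded_linear_vec_nth] mexp_sums)
  then show ?thesis
    by (simp add: sums_iff mpow_scaleR mult.commute)
qed

lemma mexp_zero [simp]: "mexp 0 = mat 1"
proof -
  have "(\<lambda>m. (1 / fact m) *\<^sub>R mpow 0 m) sums ((1 / fact 0) *\<^sub>R mpow 0 0 :: real^'n^'n)"
  proof (rule sums_single[THEN back_subst[of "\<lambda>f. f sums _"]])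
    show "(\<lambda>m. if m = 0 then (1 / fact m) *\<^sub>R mpow 0 m else 0)
        = (\<lambda>m. (1 / fact m) *\<^sub>R mpow (0 :: real^'n^'n) m)"
      by (rule ext, case_tac m) (simp_all add: matmul.zero_left)
  qed
  then show ?thesis
    using mexp_sums sums_unique2 by fastforce
qed

text \<open>The relation passes to every power and then to the sum, because multiplication by
  \<open>M\<close> is continuous. \<open>B = A\<close> is the commuting case; \<open>B = - A\<close>
  is the anticommuting case, where moving \<open>M\<close> across inverts the exponential.\<close>

lemma mexp_intertwine:
  fixes M A B :: "real^'n^'n"
  assumes "M ** A = B ** M"
  shows "M ** mexp A = mexp B ** M"
proof -
  have "(\<lambda>m. M ** ((1 / fact m) *\<^sub>R mpow A m)) sums (M ** mexp A)"
    by (rule bounded_linear.sums[OF matmul.bounded_linear_right mexp_sums])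
  moreover have "(\<lambda>m. ((1 / fact m) *\<^sub>R mpow B m) ** M) sums (mexp B ** M)"
    by (rule bounded_linear.sums[OF matmul.bounded_linear_left mexp_sums])
  ultimately show ?thesis
    by (simp add: matmul.scaleR_left matmul.scaleR_right mpow_intertwine[OF assms] sums_unique2)
qed

lemma transpose_mexp: "transpose (mexp A) = mexp (transpose A)"
proof -
  have "(\<lambda>m. transpose ((1 / fact m) *\<^sub>R mpow A m)) sums transpose (mexp A)"
    by (intro bounded_linear.sums[OF bounded_linear_transpose] mexp_sums)
  then show ?thesis
    using mexp_sums[of "transpose A"] by (simp add: transpose_linear transpose_mpow sums_unique2)
qed

lemma has_vector_derivative_mexp:
  fixes A :: "real^'n^'n"
  shows "((\<lambda>t. mexp (t *\<^sub>R A)) has_vector_derivative A ** mexp (t *\<^sub>R A)) (at t)"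
proof -
  have entry: "((\<lambda>t. mexp (t *\<^sub>R A) $ i $ j) has_real_derivative (A ** mexp (t *\<^sub>R A)) $ i $ j) (at t)"
    for i j
  proof -
    \<comment> \<open>Differentiation shifts the coefficients by one; the surplus factor of
      \<open>mpow A (Suc m)\<close> comes out on the left as \<open>A\<close>, and
      \<open>Suc m\<close> cancels against the factorial.\<close>
    have "diffs (\<lambda>m. mpow A m $ i $ j / fact m) m * t ^ m
        = (A ** ((1 / fact m) *\<^sub>R mpow (t *\<^sub>R A) m)) $ i $ j" for m
      by (simp add: diffs_def mpow_scaleR matmul.scaleR_right field_simps del: of_nat_Suc)
    moreover have "(\<lambda>m. (A ** ((1 / fact m) *\<^sub>R mpow (t *\<^sub>R A) m)) $ i $ j)
        sums ((A ** mexp (t *\<^sub>R A)) $ i $ j)"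
      by (intro bounded_linear.sums[OF bounded_linear_vec_nth]
          bounded_linear.sums[OF matmul.bounded_linear_right] mexp_sums)
    ultimately have "(\<Sum>m. diffs (\<lambda>m. mpow A m $ i $ j / fact m) m * t ^ m)
        = (A ** mexp (t *\<^sub>R A)) $ i $ j"
      by (simp add: sums_iff)
    then show ?thesis
      using termdiffs_strong_converges_everywhere[OF summable_mexp_entry, of A i j t]
      by (simp add: mexp_scaleR_entry)
  qed
  show ?thesis
    unfolding has_vector_derivative_def
  \<comment> \<open>Every basis matrix has a single entry 1, so the components are exactly the
    entries treated above.\<close>
  proof (subst has_derivative_componentwise_within, intro ballI)
    fix b :: "real^'n^'n" assume "b \<in> Basis"
    then obtain i j where b: "b = axis i (axis j 1)"
      unfolding Basis_vec_def by auto
    show "((\<lambda>x. mexp (x *\<^sub>R A) \<bullet> b) has_derivative (\<lambda>x. x *\<^sub>R (A ** mexp (t *\<^sub>R A)) \<bullet> b)) (at t)"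
      using entry[of i j, THEN has_field_derivative_imp_has_derivative]
      by (simp add: b inner_axis mult.commute[of _ "_ $ i $ j"])
  qed
qed

section \<open>Linear equations with constant coefficients\<close>

lemma has_vector_derivative_mult_mexp:
  fixes M A :: "real^'n^'n"
  shows "((\<lambda>t. M ** mexp (t *\<^sub>R A)) has_vector_derivative M ** A ** mexp (t *\<^sub>R A)) (at t)"
  using bounded_linear.has_vector_derivative[OF matmul.bounded_linear_right
      has_vector_derivative_mexp, of M A t]
  by (simp add: matrix_mul_assoc)

lemma mexp_commute: "mexp (t *\<^sub>R A) ** A = A ** mexp (t *\<^sub>R A)"
  by (rule mexp_intertwine[symmetric]) (simp add: matmul.scaleR_left matmul.scaleR_right)

text \<open>Integrating factor: the product rule gives two terms that cancel, and a vanishing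
  derivative on the convex set \<open>J\<close> forces a constant.\<close>

lemma linear_ode_mult_mexp_constant:
  fixes c :: "real \<Rightarrow> real^'n^'n"
  assumes J: "is_interval J" "0 \<in> J" "t \<in> J"
    and c: "\<And>t. t \<in> J \<Longrightarrow> (c has_vector_derivative c t ** A) (at t)"
  shows "c t ** mexp (- (t *\<^sub>R A)) = c 0"
proof -
  have "((\<lambda>t. c t ** mexp (t *\<^sub>R (- A))) has_vector_derivative
      c t ** (- A ** mexp (t *\<^sub>R (- A))) + c t ** A ** mexp (t *\<^sub>R (- A))) (at t within J)"
    if "t \<in> J" for t
    by (intro has_vector_derivative_at_within[OF matmul.has_vector_derivative]
        c[OF that] has_vector_derivative_mexp)
  then have "((\<lambda>t. c t ** mexp (- (t *\<^sub>R A))) has_vector_derivative 0) (at t within J)"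
    if "t \<in> J" for t
    using that by (simp add: matrix_mul_assoc matmul.minus_left matmul.minus_right)
  from has_vector_derivative_zero_constant[OF is_interval_convex[OF J(1)] this]
  obtain C where "\<And>t. t \<in> J \<Longrightarrow> c t ** mexp (- (t *\<^sub>R A)) = C"
    by blast
  from this[OF J(2)] this[OF J(3)] show ?thesis
    by simp
qed

text \<open>The curve \<open>mexp (t *\<^sub>R A)\<close> itself solves the linear equation and
  starts at the identity; evaluating the constant at \<open>t = 1\<close> gives the inverse without
  multiplying series.\<close>

lemma mexp_minus_right: "mexp A ** mexp (- A) = mat 1"
  using linear_ode_mult_mexp_constant[of UNIV 1 "\<lambda>t. mexp (t *\<^sub>R A)" A]
    has_vector_derivative_mexp[of A]
  by (simp add: is_interval_univ mexp_commute)

lemma mexp_minus_left: "mexp (- A) ** mexp A = mat 1"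
  using mexp_minus_right[of "- A"] by simp

lemma linear_ode_unique:
  fixes c :: "real \<Rightarrow> real^'n^'n"
  assumes "is_interval J" "0 \<in> J" "t \<in> J"
    and "\<And>t. t \<in> J \<Longrightarrow> (c has_vector_derivative c t ** A) (at t)"
  shows "c t = c 0 ** mexp (t *\<^sub>R A)"
proof -
  have "c 0 ** mexp (t *\<^sub>R A) = c t ** (mexp (- (t *\<^sub>R A)) ** mexp (t *\<^sub>R A))"
    by (simp only: matrix_mul_assoc linear_ode_mult_mexp_constant[OF assms])
  then show ?thesis
    by (simp add: mexp_minus_left)
qed

section \<open>Curves\<close>

lemma velocity_cong:
  assumes "open J" "t \<in> J" "\<And>s. s \<in> J \<Longrightarrow> f s = g s"
  shows "velocity f t = velocity g t"
  unfolding velocity_def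
  by (rule vector_derivative_cong_eq)
     (use assms in \<open>auto simp: eventually_nhds\<close>)

lemma velocity_funpow_cong:
  assumes "open J" "\<And>s. s \<in> J \<Longrightarrow> f s = g s" "t \<in> J"
  shows "(velocity ^^ m) f t = (velocity ^^ m) g t"
  using assms(3)
  by (induction m arbitrary: t) (auto intro: velocity_cong[OF assms(1)] assms(2))

text \<open>Agreement on an open set is inherited by all iterated velocities. This later transfers
  smoothness from an explicit exponential curve to a solution known only to agree with it on
  \<open>J\<close>.\<close>

lemma smooth_curve_on_cong:
  assumes "open J" "\<And>s. s \<in> J \<Longrightarrow> f s = g s" "smooth_curve_on J g"
  shows "smooth_curve_on J f"
  unfolding smooth_curve_on_def
proof (intro allI ballI)
  fix m t assume t: "t \<in> J"
  then have "((velocity ^^ m) g has_derivative frechet_derivative ((velocity ^^ m) g) (at t)) (at t)"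
    using assms(3) by (simp add: smooth_curve_on_def frechet_derivative_works)
  then have "((velocity ^^ m) f has_derivative frechet_derivative ((velocity ^^ m) g) (at t)) (at t)"
    by (rule has_derivative_transform_within_open[OF _ assms(1) t])
       (simp add: velocity_funpow_cong[OF assms(1,2)])
  then show "(velocity ^^ m) f differentiable at t"
    by (auto simp: differentiable_def)
qed

lemma smooth_curve_onD:
  assumes "smooth_curve_on J c" "t \<in> J"
  shows "c differentiable at t" "velocity c differentiable at t"
  using assms spec[of "\<lambda>m. \<forall>t\<in>J. (velocity ^^ m) c differentiable at t" 0]
    spec[of "\<lambda>m. \<forall>t\<in>J. (velocity ^^ m) c differentiable at t" 1]
  by (auto simp: smooth_curve_on_def)

lemma velocity_works:
  "c differentiable at t \<Longrightarrow> (c has_vector_derivative velocity c t) (at t)"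
  by (simp add: velocity_def vector_derivative_works)

lemma velocity_mult_mexp:
  fixes M A :: "real^'n^'n"
  shows "velocity (\<lambda>t. M ** mexp (t *\<^sub>R A)) = (\<lambda>t. M ** A ** mexp (t *\<^sub>R A))"
  by (auto simp: velocity_def intro!: vector_derivative_at has_vector_derivative_mult_mexp)

lemma velocity_velocity_mult_mexp:
  fixes M A :: "real^'n^'n"
  shows "velocity (velocity (\<lambda>t. M ** mexp (t *\<^sub>R A))) t = M ** mexp (t *\<^sub>R A) ** A ** A"
proof -
  have "A ** (A ** mexp (t *\<^sub>R A)) = mexp (t *\<^sub>R A) ** (A ** A)"
    by (metis matrix_mul_assoc mexp_commute)
  moreover have "velocity (velocity (\<lambda>t. M ** mexp (t *\<^sub>R A))) t = M ** (A ** (A ** mexp (t *\<^sub>R A)))"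
    by (simp only: velocity_mult_mexp matrix_mul_assoc)
  ultimately show ?thesis
    by (simp only: matrix_mul_assoc)
qed

text \<open>Differentiation only replaces \<open>M\<close> by \<open>M ** A\<close>, so the family
  is closed under \<open>velocity\<close> and the induction generalises over
  \<open>M\<close>.\<close>

lemma smooth_curve_on_mult_mexp:
  fixes M A :: "real^'n^'n"
  shows "smooth_curve_on J (\<lambda>t. M ** mexp (t *\<^sub>R A))"
proof -
  have "(velocity ^^ m) (\<lambda>t. M ** mexp (t *\<^sub>R A)) differentiable at t" for m t
  proof (induction m arbitrary: M)
    case 0
    then show ?case
      using has_vector_derivative_mult_mexp
      by (auto simp: has_vector_derivative_def differentiable_def)
  next
    case (Suc m)
    then show ?case
      by (simp only: funpow_Suc_right o_apply velocity_mult_mexp)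
  qed
  then show ?thesis
    by (simp add: smooth_curve_on_def)
qed

lemma symmetric_velocity:
  fixes c :: "real \<Rightarrow> real^'n^'n"
  assumes "open J" "t \<in> J" "c differentiable at t" "\<And>s. s \<in> J \<Longrightarrow> transpose (c s) = c s"
  shows "transpose (velocity c t) = velocity c t"
proof -
  note d = velocity_works[OF assms(3)]
  have "((\<lambda>s. transpose (c s)) has_vector_derivative velocity c t) (at t)"
    by (rule has_vector_derivative_transform_within_open[OF d assms(1,2)]) (simp add: assms(4))
  then show ?thesis
    using bounded_linear.has_vector_derivative[OF bounded_linear_transpose d] vector_derivative_unique_at by blast
qed

section \<open>Tangent spaces of the Grassmannian\<close>

text \<open>The residual \<open>a - y\<close> is orthogonal to \<open>y - z\<close>, so by
  Pythagoras no \<open>z\<close> in \<open>S\<close> is nearer to \<open>a\<close>. This makes the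
  projection in \<open>covariant_deriv\<close> computable.\<close>

lemma closest_point_subspace_eq:
  fixes S :: "'a::euclidean_space set"
  assumes "subspace S" "y \<in> S" "\<And>z. z \<in> S \<Longrightarrow> (a - y) \<bullet> z = 0"
  shows "closest_point S a = y"
proof (rule closest_point_unique[symmetric])
  show "\<forall>z\<in>S. dist a y \<le> dist a z"
  proof
    fix z assume "z \<in> S"
    then have "(a - y) \<bullet> (y - z) = 0"
      using assms by (simp add: subspace_diff)
    then have "norm (a - z) ^ 2 = norm (a - y) ^ 2 + norm (y - z) ^ 2"
      using norm_add_Pythagorean[of "a - y" "y - z"] by (simp add: orthogonal_def)
    then have "norm (a - y) ^ 2 \<le> norm (a - z) ^ 2"
      by simp
    then show "dist a y \<le> dist a z"
      unfolding dist_norm by (rule power2_le_imp_le) simp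
  qed
qed (use assms in \<open>auto simp: subspace_imp_convex closed_subspace\<close>)

lemma GrD:
  assumes "P \<in> Gr k"
  shows "transpose P = P" "P ** P = mat 1"
  using assms by (auto simp: Gr_def orthogonal_matrix_def)

text \<open>Product rule applied to \<open>c s ** c s = mat 1\<close>, which holds throughout the
  open set \<open>J\<close>.\<close>

lemma Gr_curve_velocity:
  assumes "open J" "t \<in> J" "c ` J \<subseteq> Gr k" "c differentiable at t"
  shows "c t ** velocity c t + velocity c t ** c t = 0"
proof -
  note d = velocity_works[OF assms(4)]
  have "((\<lambda>s. c s ** c s) has_vector_derivative 0) (at t)"
    by (rule has_vector_derivative_transform_within_open[OF has_vector_derivative_const[of "mat 1"] assms(1,2)])
       (metis GrD(2) assms(3) image_subset_iff)
  then show ?thesis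
    by (rule vector_derivative_unique_at[OF matmul.has_vector_derivative[OF d d]])
qed

lemma tangent_generator_anticommute:
  fixes P X :: "real^'n^'n"
  assumes "P ** P = mat 1" "P ** X + X ** P = 0"
  shows "P ** (P ** X) = - (P ** X) ** P"
proof -
  have "P ** X = - (X ** P)"
    by (rule eq_neg_iff_add_eq_0[THEN iffD2, OF assms(2)])
  then have "P ** (X ** P) = - (P ** (P ** X))"
    by (simp add: matmul.minus_right)
  then show ?thesis
    by (simp add: matmul.minus_left matrix_mul_assoc[symmetric])
qed

text \<open>The generator \<open>P ** X\<close> is skew, so transposing its exponential inverts it;
  it anticommutes with \<open>P\<close>, so moving \<open>P\<close> across inverts it as well.
  Together these make the product symmetric and its own inverse. The trace stays constant because
  its derivative vanishes.\<close>

lemma mult_mexp_in_Gr: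
  fixes P X :: "real^'n^'n"
  assumes P: "P \<in> Gr k" and "transpose X = X" "P ** X + X ** P = 0"
  shows "P ** mexp (t *\<^sub>R (P ** X)) \<in> Gr k"
proof -
  let ?K = "P ** X" and ?E = "\<lambda>t. mexp (t *\<^sub>R (P ** X))" and ?F = "\<lambda>t. mexp (- (t *\<^sub>R (P ** X)))"
  note P' = GrD[OF P]
  have "transpose ?K = - ?K"
    by (simp add: matrix_transpose_mul P' assms(2) minus_unique[OF assms(3)])
  then have tE: "transpose (?E t) = ?F t" for t
    by (simp only: transpose_mexp transpose_scalar scaleR_minus_right)
  have PE: "P ** ?E t = ?F t ** P" for t
    by (rule mexp_intertwine)
       (simp add: matmul.scaleR_left matmul.scaleR_right tangent_generator_anticommute[OF P'(2) assms(3)]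
         matmul.minus_left)
  have sym: "transpose (P ** ?E t) = P ** ?E t"
    by (metis matrix_transpose_mul tE PE P'(1))
  have "P ** ?E t ** (P ** ?E t) = ?F t ** (P ** P) ** ?E t"
    by (metis PE matrix_mul_assoc)
  then have orth: "P ** ?E t ** (P ** ?E t) = mat 1"
    by (simp add: P' mexp_minus_left)
  \<comment> \<open>Anticommutation changes the sign, while cyclicity of the trace restores the
    original product, so the trace equals its own negative.\<close>
  have "trace (P ** ?K ** ?E t) = 0" for t
  proof -
    have "trace (P ** ?K ** ?E t) = - trace (?K ** (P ** ?E t))"
      by (simp add: tangent_generator_anticommute[OF P'(2) assms(3)] matmul.minus_left
          trace_def sum_negf flip: matrix_mul_assoc)
    also have "\<dots> = - trace (P ** ?K ** ?E t)"
      by (subst trace_mul_sym) (simp add: mexp_commute flip: matrix_mul_assoc)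
    finally show ?thesis by simp
  qed
  moreover have "bounded_linear (trace :: real^'n^'n \<Rightarrow> real)"
    by (intro linear_conv_bounded_linear[THEN iffD1] linearI)
       (simp_all add: trace_def sum.distrib sum_distrib_left)
  then have "((\<lambda>t. trace (P ** ?E t)) has_vector_derivative trace (P ** ?K ** ?E t)) (at t)" for t
    by (rule bounded_linear.has_vector_derivative) (rule has_vector_derivative_mult_mexp)
  ultimately have "((\<lambda>t. trace (P ** ?E t)) has_vector_derivative 0) (at t within UNIV)" for t
    by metis
  from has_vector_derivative_zero_constant[OF convex_UNIV this]
  have "trace (P ** ?E t) = trace (P ** ?E 0)"
    by (metis UNIV_I)
  then have "trace (P ** ?E t) = trace P"
    by simp
  then show ?thesis
    using P sym orth by (simp add: Gr_def orthogonal_matrix)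
qed

lemma tangent_space_Gr:
  assumes P: "P \<in> Gr k"
  shows "tangent_space (Gr k) P = {X. transpose X = X \<and> P ** X + X ** P = 0}"
proof (intro set_eqI iffI; clarsimp)
  fix X assume X: "X \<in> tangent_space (Gr k) P"
  then obtain c e where c: "e > 0" "smooth_curve_on {-e<..<e} c" "c ` {-e<..<e} \<subseteq> Gr k"
    "c 0 = P" "velocity c 0 = X"
    by (auto simp: tangent_space_def)
  have "c differentiable at 0"
    using smooth_curve_onD(1)[OF c(2)] c(1) by simp
  then show "transpose X = X \<and> P ** X + X ** P = 0"
    using Gr_curve_velocity[OF _ _ c(3), of 0] c tangent_Gr_symmetric[OF X] by simp
next
  fix X assume X: "transpose X = X" "P ** X + X ** P = 0"
  \<comment> \<open>The generator \<open>P ** X\<close> is chosen so that the initial velocity is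
    \<open>P ** (P ** X) = X\<close>.\<close>
  let ?c = "\<lambda>t. P ** mexp (t *\<^sub>R (P ** X))"
  have "velocity ?c 0 = X"
    by (simp add: velocity_mult_mexp matrix_mul_assoc GrD[OF P])
  moreover have "?c ` {-1<..<1} \<subseteq> Gr k"
    using mult_mexp_in_Gr[OF P X] by blast
  ultimately show "X \<in> tangent_space (Gr k) P"
    unfolding tangent_space_def
    by (intro CollectI exI[of _ ?c] exI[of _ "1::real"]) (simp add: smooth_curve_on_mult_mexp)
qed

section \<open>Orthogonal projection and the geodesic equation\<close>

lemma closest_point_tangent_Gr:
  assumes P: "P \<in> Gr k" and W: "transpose W = W"
  shows "closest_point (tangent_space (Gr k) P) W = (1/2) *\<^sub>R (W - P ** W ** P)"
proof (rule closest_point_subspace_eq)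
  note P' = GrD[OF P]
  note arith = matmul.add_left matmul.add_right matmul.diff_left matmul.diff_right
    matmul.scaleR_left matmul.scaleR_right
  show "subspace (tangent_space (Gr k) P)"
    unfolding tangent_space_Gr[OF P] subspace_def
  proof (intro conjI ballI allI)
    show "0 \<in> {X. transpose X = X \<and> P ** X + X ** P = 0}"
      by (simp add: transpose_linear matmul.zero_left matmul.zero_right)
  next
    fix X Y assume "X \<in> {X. transpose X = X \<and> P ** X + X ** P = 0}"
      "Y \<in> {X. transpose X = X \<and> P ** X + X ** P = 0}"
    then show "X + Y \<in> {X. transpose X = X \<and> P ** X + X ** P = 0}"
      by (simp add: transpose_linear arith) (metis (no_types, lifting) add.commute add.left_commute add.right_neutral)
  next
    fix X and r :: real assume "X \<in> {X. transpose X = X \<and> P ** X + X ** P = 0}"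
    then show "r *\<^sub>R X \<in> {X. transpose X = X \<and> P ** X + X ** P = 0}"
      by (simp add: transpose_linear arith flip: scaleR_add_right)
  qed
  \<comment> \<open>With these identities, multiplying \<open>W - P ** W ** P\<close> by
    \<open>P\<close> gives \<open>P ** W - W ** P\<close> on the left and its negative on the right,
    so the anticommutator vanishes.\<close>
  have 1: "P ** (P ** W ** P) = W ** P"
    by (simp add: matrix_mul_assoc P')
  have 2: "P ** W ** P ** P = P ** W"
    by (simp add: P' flip: matrix_mul_assoc)
  have "transpose (P ** W ** P) = P ** W ** P"
    by (simp add: matrix_transpose_mul P' W matrix_mul_assoc)
  then show "(1/2) *\<^sub>R (W - P ** W ** P) \<in> tangent_space (Gr k) P"
    by (simp add: tangent_space_Gr[OF P] transpose_linear W arith 1 2 flip: scaleR_add_right)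
  fix Z assume "Z \<in> tangent_space (Gr k) P"
  then have Z: "P ** Z = - (Z ** P)"
    using eq_neg_iff_add_eq_0[of "P ** Z" "Z ** P"] by (simp add: tangent_space_Gr[OF P])
  \<comment> \<open>Moving \<open>Z\<close> past \<open>P\<close> changes the sign, then cyclicity
    and \<open>P ** P = mat 1\<close> remove both copies of \<open>P\<close>. Hence the residual,
    half of \<open>W + P ** W ** P\<close>, is orthogonal to \<open>Z\<close>.\<close>
  have "trace (P ** W ** P ** Z) = trace (P ** W ** (P ** Z))"
    by (simp add: matrix_mul_assoc)
  also have "\<dots> = - trace (P ** (W ** Z ** P))"
    by (simp add: Z matmul.minus_right matrix_mul_assoc trace_def sum_negf)
  also have "\<dots> = - trace (W ** Z)"
    by (subst trace_mul_sym) (simp add: P' flip: matrix_mul_assoc)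
  finally have "(W + P ** W ** P) \<bullet> Z = 0"
    by (simp add: inner_matrix_eq_trace transpose_linear W \<open>transpose (P ** W ** P) = _\<close> arith trace_add)
  moreover have "W - (1/2) *\<^sub>R (W - P ** W ** P) = (1/2) *\<^sub>R (W + P ** W ** P)"
    by (simp add: scaleR_add_right scaleR_diff_right)
  ultimately show "(W - (1/2) *\<^sub>R (W - P ** W ** P)) \<bullet> Z = 0"
    by simp
qed

text \<open>Symmetry of \<open>c\<close> passes to its second derivative, so the transposes in the
  equation disappear. Since \<open>c t\<close> squares to the identity, a vanishing projection of
  the second derivative means exactly that it commutes with \<open>c t\<close>.\<close>

lemma covariant_deriv_velocity_Gr_eq_0_iff:
  assumes J: "open J" "t \<in> J" and c: "c ` J \<subseteq> Gr k"
    and d: "\<And>s. s \<in> J \<Longrightarrow> c differentiable at s" "velocity c differentiable at t"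
  shows "covariant_deriv (Gr k) c (velocity c) t = 0 \<longleftrightarrow>
    transpose (c t) ** velocity (velocity c) t - transpose (velocity (velocity c) t) ** c t = 0"
proof -
  let ?P = "c t" and ?W = "velocity (velocity c) t"
  have P: "?P \<in> Gr k"
    using J c by blast
  note P' = GrD[OF P]
  have sc: "transpose (c s) = c s" if "s \<in> J" for s
    using c that GrD(1) by blast
  have W: "transpose ?W = ?W"
    by (rule symmetric_velocity[OF J d(2)]) (rule symmetric_velocity[OF J(1) _ d(1) sc])
  have "covariant_deriv (Gr k) c (velocity c) t = 0 \<longleftrightarrow> ?W = ?P ** ?W ** ?P"
    by (simp add: covariant_deriv_def closest_point_tangent_Gr[OF P W])
  also have "\<dots> \<longleftrightarrow> ?P ** ?W = ?W ** ?P"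
  proof
    assume *: "?W = ?P ** ?W ** ?P"
    show "?P ** ?W = ?W ** ?P"
      by (subst (2) *) (simp add: P' flip: matrix_mul_assoc)
  next
    assume "?P ** ?W = ?W ** ?P"
    then show "?W = ?P ** ?W ** ?P"
      by (simp add: P' flip: matrix_mul_assoc)
  qed
  finally show ?thesis
    by (simp add: P' W)
qed

text \<open>Differentiating \<open>c\<^sup>2 = 1\<close> twice gives \<open>c c'' + 2 c'\<^sup>2 + c'' c = 0\<close>, so where \<open>c\<close> and \<open>c''\<close>
  commute the derivative \<open>c'\<^sup>2 + c c''\<close> of \<open>c c'\<close> vanishes.\<close>
lemma Gr_ode_solution:
  assumes J: "open J" "is_interval J" "0 \<in> J" "t \<in> J" and c: "c ` J \<subseteq> Gr k"
    and d: "\<And>s. s \<in> J \<Longrightarrow> c differentiable at s" "\<And>s. s \<in> J \<Longrightarrow> velocity c differentiable at s"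
    and ode: "\<And>s. s \<in> J \<Longrightarrow>
      transpose (c s) ** velocity (velocity c) s - transpose (velocity (velocity c) s) ** c s = 0"
  shows "c t = c 0 ** mexp (t *\<^sub>R (c 0 ** velocity c 0))"
proof -
  note d' = velocity_works[OF d(1)] velocity_works[OF d(2)]
  have P: "transpose (c s) = c s" "c s ** c s = mat 1" if "s \<in> J" for s
    using c that GrD by blast+
  have W: "transpose (velocity (velocity c) s) = velocity (velocity c) s" if "s \<in> J" for s
    by (rule symmetric_velocity[OF J(1) that d(2)[OF that]])
       (rule symmetric_velocity[OF J(1) _ d(1) P(1)])
  have deriv0: "c s ** velocity (velocity c) s + velocity c s ** velocity c s = 0" if s: "s \<in> J" for s
  proof -
    let ?u = "velocity c s" and ?W = "velocity (velocity c) s"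
    have "((\<lambda>s. c s ** velocity c s + velocity c s ** c s) has_vector_derivative 0) (at s)"
      by (rule has_vector_derivative_transform_within_open[OF has_vector_derivative_const[of 0] J(1) s])
         (simp add: Gr_curve_velocity[OF J(1) _ c d(1)])
    moreover have "((\<lambda>s. c s ** velocity c s + velocity c s ** c s) has_vector_derivative
        (c s ** ?W + ?u ** ?u) + (?u ** ?u + ?W ** c s)) (at s)"
      by (intro has_vector_derivative_add matmul.has_vector_derivative d' s)
    ultimately have "(c s ** ?W + ?u ** ?u) + (?u ** ?u + ?W ** c s) = 0"
      by (rule vector_derivative_unique_at[rotated])
    moreover have "?W ** c s = c s ** ?W"
      using ode[OF s] by (simp add: P(1)[OF s] W[OF s])
    ultimately have "2 *\<^sub>R (c s ** ?W + ?u ** ?u) = 0"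
      by (simp add: scaleR_2 add_ac)
    then show ?thesis by simp
  qed
  have "((\<lambda>s. c s ** velocity c s) has_vector_derivative 0) (at s within J)" if "s \<in> J" for s
    using matmul.has_vector_derivative[OF d'(1)[OF that] d'(2)[OF that]]
    by (simp add: deriv0[OF that] has_vector_derivative_at_within)
  from has_vector_derivative_zero_constant[OF is_interval_convex[OF J(2)] this]
  have const: "c s ** velocity c s = c 0 ** velocity c 0" if "s \<in> J" for s
    using that J(3) by metis
  \<comment> \<open>Multiplying the constant from the left by \<open>c s\<close> cancels
    \<open>c s ** c s\<close>.\<close>
  have "velocity c s = c s ** (c 0 ** velocity c 0)" if "s \<in> J" for s
    by (simp add: const[OF that, symmetric] matrix_mul_assoc P[OF that])
  then show ?thesis
    using d'(1) by (intro linear_ode_unique[OF J(2-4)]) metis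
qed

text \<open>Only two derivatives are assumed, whereas a geodesic is smooth. The gap closes because a
  solution coincides on \<open>J\<close> with an exponential curve and inherits its
  smoothness.\<close>

lemma geodesic_on_Gr_iff_ode:
  assumes J: "open J" "is_interval J" "0 \<in> J" and c: "c ` J \<subseteq> Gr k"
    and d: "\<And>s. s \<in> J \<Longrightarrow> c differentiable at s" "\<And>s. s \<in> J \<Longrightarrow> velocity c differentiable at s"
  shows "geodesic_on (Gr k) J c \<longleftrightarrow>
    (\<forall>t\<in>J. transpose (c t) ** velocity (velocity c) t - transpose (velocity (velocity c) t) ** c t = 0)"
    (is "_ \<longleftrightarrow> ?ode")
proof -
  have "smooth_curve_on J c" if ?ode
  proof (rule smooth_curve_on_cong[OF J(1) _ smooth_curve_on_mult_mexp])
    show "c t = c 0 ** mexp (t *\<^sub>R (c 0 ** velocity c 0))" if "t \<in> J" for t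
      by (rule Gr_ode_solution[OF J that c d bspec[OF \<open>?ode\<close>]])
  qed
  moreover have "(\<forall>t\<in>J. covariant_deriv (Gr k) c (velocity c) t = 0) \<longleftrightarrow> ?ode"
    by (intro ball_cong refl covariant_deriv_velocity_Gr_eq_0_iff[OF J(1) _ c d])
  ultimately show ?thesis
    by (auto simp only: geodesic_on_def J c)
qed

text \<open>Uniqueness: the geodesic equation determines the curve from its position and velocity at
  0.\<close>

lemma geodesic_on_Gr_eq:
  assumes "geodesic_on (Gr k) J c" "0 \<in> J" "t \<in> J"
  shows "c t = c 0 ** mexp (t *\<^sub>R (c 0 ** velocity c 0))"
proof -
  have J: "open J" "is_interval J" "c ` J \<subseteq> Gr k" "smooth_curve_on J c"
    using assms(1) by (auto simp: geodesic_on_def)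
  note d = smooth_curve_onD[OF J(4)]
  have ode: "\<forall>t\<in>J. transpose (c t) ** velocity (velocity c) t - transpose (velocity (velocity c) t) ** c t = 0"
    by (rule iffD1[OF geodesic_on_Gr_iff_ode[OF J(1,2) assms(2) J(3) d] assms(1)])
  show ?thesis
    by (rule Gr_ode_solution[OF J(1,2) assms(2,3) J(3) d bspec[OF ode]])
qed

lemma geodesic_on_Gr_mult_mexp:
  assumes P: "P \<in> Gr k" and X: "X \<in> tangent_space (Gr k) P"
  shows "geodesic_on (Gr k) UNIV (\<lambda>t. P ** mexp (t *\<^sub>R (P ** X)))"
proof -
  let ?c = "\<lambda>t. P ** mexp (t *\<^sub>R (P ** X))"
  note P' = GrD[OF P]
  have X': "transpose X = X" "P ** X + X ** P = 0"
    using X by (simp_all add: tangent_space_Gr[OF P])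
  have Gr: "?c t \<in> Gr k" for t
    by (rule mult_mexp_in_Gr[OF P X'])
  let ?K = "P ** X"
  have K: "transpose ?K = - ?K"
    by (simp add: matrix_transpose_mul P' X'(1) minus_unique[OF X'(2)])
  have v: "velocity (velocity ?c) t = ?c t ** ?K ** ?K" for t
    by (rule velocity_velocity_mult_mexp)
  \<comment> \<open>With \<open>C = ?c t\<close> the second derivative is
    \<open>C ** ?K ** ?K\<close>. As \<open>?K\<close> is skew and \<open>C\<close> a symmetric
    involution, both products in the equation equal \<open>?K ** ?K\<close>.\<close>
  have ode: "transpose (?c t) ** velocity (velocity ?c) t - transpose (velocity (velocity ?c) t) ** ?c t = 0"
    for t
  proof -
    define C where "C = ?c t"
    have C: "transpose C = C" "C ** C = mat 1"
      unfolding C_def by (rule GrD[OF Gr])+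
    have "transpose (C ** ?K ** ?K) = transpose ?K ** (transpose ?K ** C)"
      by (simp only: matrix_transpose_mul[of _ ?K] C(1))
    also have "\<dots> = ?K ** (?K ** C)"
      unfolding K by (simp only: matmul.minus_left matmul.minus_right minus_minus)
    finally have "transpose (C ** ?K ** ?K) ** C = ?K ** ?K ** (C ** C)"
      by (simp only: matrix_mul_assoc)
    moreover have "C ** (C ** ?K ** ?K) = (C ** C) ** (?K ** ?K)"
      by (simp only: matrix_mul_assoc)
    ultimately show ?thesis
      unfolding v C_def[symmetric] C by (simp only: matrix_mul_lid matrix_mul_rid diff_self)
  qed
  have "?c ` UNIV \<subseteq> Gr k"
    using Gr by blast
  then have iff: "geodesic_on (Gr k) UNIV ?c \<longleftrightarrow> (\<forall>t\<in>UNIV. transpose (?c t) ** velocity (velocity ?c) t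
      - transpose (velocity (velocity ?c) t) ** ?c t = 0)"
    by (intro geodesic_on_Gr_iff_ode open_UNIV is_interval_univ UNIV_I
      smooth_curve_onD[of UNIV ?c] smooth_curve_on_mult_mexp)
  show ?thesis
    unfolding iff by (rule ballI) (rule ode)
qed

text \<open>Moving \<open>S\<close> across the left exponential inverts it, so the two
  half-parameter factors become equal and sit side by side. Their product solves a linear equation
  with the full generator, and uniqueness merges them into one exponential; this accounts for the
  \<open>t / 2\<close>.\<close>

lemma mexp_conjugate_curve:
  fixes V S A :: "real^'n^'n"
  assumes V: "transpose V ** V = mat 1" and SA: "A ** S = - (S ** A)"
  shows "V ** mexp ((t / 2) *\<^sub>R A) ** S ** mexp ((t / 2) *\<^sub>R (- A)) ** transpose V
    = V ** S ** transpose V ** mexp (t *\<^sub>R (V ** (- A) ** transpose V))"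
proof -
  define D where "D = (1/2) *\<^sub>R (- A)"
  let ?E = "\<lambda>t. mexp (t *\<^sub>R D)"
  have S: "S ** ?E t = mexp ((t / 2) *\<^sub>R A) ** S" for t
    by (rule mexp_intertwine) (simp add: D_def SA matmul.scaleR_left matmul.scaleR_right matmul.minus_right)
  have E: "mexp ((t / 2) *\<^sub>R (- A)) = ?E t" for t
    by (simp add: D_def)
  have eq: "V ** mexp ((t / 2) *\<^sub>R A) ** S ** mexp ((t / 2) *\<^sub>R (- A)) ** transpose V
      = V ** S ** (?E t ** ?E t) ** transpose V" for t
  proof -
    have "V ** mexp ((t / 2) *\<^sub>R A) ** S = V ** S ** ?E t"
      by (simp only: S flip: matrix_mul_assoc)
    then show ?thesis
      by (simp only: E matrix_mul_assoc)
  qed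
  have D: "D + D = - A"
    unfolding D_def scaleR_add_left[symmetric] by simp
  have "((\<lambda>t. V ** S ** (?E t ** ?E t) ** transpose V) has_vector_derivative
      V ** S ** (?E t ** (D ** ?E t) + D ** ?E t ** ?E t) ** transpose V) (at t)" for t
    by (rule bounded_linear.has_vector_derivative[OF matmul.bounded_linear_left
          bounded_linear.has_vector_derivative[OF matmul.bounded_linear_right
            matmul.has_vector_derivative[OF has_vector_derivative_mexp has_vector_derivative_mexp]]])
  \<comment> \<open>Both product-rule terms move \<open>D\<close> to the right, where
    \<open>D + D = - A\<close>; inserting \<open>transpose V ** V\<close> produces the conjugated
    generator.\<close>
  moreover have "V ** S ** (?E t ** (D ** ?E t) + D ** ?E t ** ?E t) ** transpose V
      = V ** S ** (?E t ** ?E t) ** transpose V ** (V ** (- A) ** transpose V)" for t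
  proof -
    have "?E t ** (D ** ?E t) = ?E t ** ?E t ** D" "D ** ?E t ** ?E t = ?E t ** ?E t ** D"
      by (metis mexp_commute matrix_mul_assoc)+
    then have "?E t ** (D ** ?E t) + D ** ?E t ** ?E t = ?E t ** ?E t ** (- A)"
      unfolding D[symmetric] matmul.add_right by (simp only:)
    moreover have "V ** S ** (?E t ** ?E t) ** transpose V ** (V ** (- A) ** transpose V)
        = V ** S ** (?E t ** ?E t) ** (transpose V ** V) ** (- A) ** transpose V"
      by (simp only: matrix_mul_assoc)
    ultimately show ?thesis
      by (simp add: V matrix_mul_assoc)
  qed
  ultimately have "((\<lambda>t. V ** S ** (?E t ** ?E t) ** transpose V) has_vector_derivative
      V ** S ** (?E t ** ?E t) ** transpose V ** (V ** (- A) ** transpose V)) (at t)" for t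
    by simp
  from linear_ode_unique[OF is_interval_univ UNIV_I UNIV_I this, of t] show ?thesis
    unfolding eq by simp
qed

section \<open>Block matrices and the signature matrix\<close>

lemma block_mat_uminus:
  "- block_mat k A B C D = block_mat k (neg_block A) (neg_block B) (neg_block C) (neg_block D)"
  by (simp add: block_mat_def neg_block_def vec_eq_iff)

text \<open>\<open>pos\<close> is strictly monotone, hence injective, so comparing positions inside
  a diagonal block, even after the shift by \<open>k\<close>, amounts to comparing indices.\<close>

lemma I_sig_eq: "I_sig k = (\<chi> i j. if i = j then if pos i < k then 1 else -1 else 0)"
proof -
  have "strict_mono (pos :: 'a \<Rightarrow> nat)"
    unfolding pos_def by (auto intro!: strict_monoI psubset_card_mono)
  then have "pos i = pos j \<longleftrightarrow> i = j" for i j :: 'a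
    by (rule strict_mono_eq)
  then show ?thesis
    by (auto simp: I_sig_def block_mat_def zero_block_def neg_block_def id_block_def
        vec_eq_iff not_less eq_diff_iff)
qed

lemma I_sig_mult: "I_sig k ** M = (\<chi> i j. if pos i < k then M $ i $ j else - M $ i $ j)"
  by (simp add: I_sig_eq matrix_matrix_mult_def vec_eq_iff if_distrib[of "\<lambda>x. x * _"] cong: if_cong)

lemma mult_I_sig: "M ** I_sig k = (\<chi> i j. if pos j < k then M $ i $ j else - M $ i $ j)"
  by (simp add: I_sig_eq matrix_matrix_mult_def vec_eq_iff if_distrib[of "\<lambda>x. _ * x"] cong: if_cong)

theorem theorem4p3:
  fixes k :: nat
    and Q X V :: "real^('n::{finite,linorder})^('n::{finite,linorder})"
    and B :: "nat \<Rightarrow> nat \<Rightarrow> real"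
    and \<gamma> :: "real \<Rightarrow> real^('n::{finite,linorder})^('n::{finite,linorder})"
  assumes k: "k \<in> {1..CARD('n)}"
    and Q_Gr: "Q \<in> Gr k"
    and X_tangent: "X \<in> tangent_space (Gr k) Q"
    and V: "orthogonal_matrix V"
    and Q: "Q = V ** I_sig k ** transpose V"
    and X: "X = V ** block_mat k zero_block B (transp_block B) zero_block ** transpose V"
    and \<gamma>: "\<gamma> = (\<lambda>t.
      V ** mexp ((t / 2) *\<^sub>R block_mat k zero_block (neg_block B) (transp_block B) zero_block)
        ** I_sig k
        ** mexp ((t / 2) *\<^sub>R block_mat k zero_block B (neg_block (transp_block B)) zero_block)
        ** transpose V)"
  shows
    "(geodesic_on (Gr k) UNIV \<gamma> \<and> \<gamma> 0 = Q \<and> velocity \<gamma> 0 = X) \<and>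
     (\<forall>J c. geodesic_on (Gr k) J c \<and> 0 \<in> J \<and> c 0 = Q \<and> velocity c 0 = X \<longrightarrow>
        (\<forall>t\<in>J. c t = \<gamma> t)) \<and>
     (\<forall>t. transpose (\<gamma> t) ** velocity (velocity \<gamma>) t
          - transpose (velocity (velocity \<gamma>) t) ** \<gamma> t = 0) \<and>
     (\<forall>J c. open J \<and> is_interval J \<and> 0 \<in> J \<and> c ` J \<subseteq> Gr k \<and>
        (\<forall>t\<in>J. c differentiable (at t)) \<and> (\<forall>t\<in>J. velocity c differentiable (at t)) \<longrightarrow>
        ((geodesic_on (Gr k) J c \<and> c 0 = Q \<and> velocity c 0 = X) \<longleftrightarrow>
         ((\<forall>t\<in>J. transpose (c t) ** velocity (velocity c) t
                 - transpose (velocity (velocity c) t) ** c t = 0)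
          \<and> c 0 = Q \<and> velocity c 0 = X)))"
proof -
  let ?A = "block_mat k zero_block (neg_block B) (transp_block B) zero_block
    :: real^('n::{finite,linorder})^('n::{finite,linorder})"
  have V': "transpose V ** V = mat 1"
    using V by (simp add: orthogonal_matrix_def)
  have A: "block_mat k zero_block B (neg_block (transp_block B)) zero_block = - ?A"
    by (simp add: block_mat_uminus) (simp add: neg_block_def zero_block_def)
  \<comment> \<open>A nonzero entry of \<open>?A\<close> lies in a row and a column carrying
    opposite signs, so scaling columns and scaling rows give opposite results.\<close>
  have "?A ** I_sig k = - (I_sig k ** ?A)"
    by (simp add: I_sig_mult mult_I_sig vec_eq_iff block_mat_def zero_block_def)
  from mexp_conjugate_curve[OF V' this]
  have "\<gamma> t = Q ** mexp (t *\<^sub>R (V ** (- ?A) ** transpose V))" for t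
    by (simp add: \<gamma> Q A)
  \<comment> \<open>Multiplying the block matrix of \<open>X\<close> by \<open>I_sig k\<close> flips
    its lower rows and yields \<open>- ?A\<close>; inserting \<open>transpose V ** V\<close> between
    the two factors then exhibits \<open>Q ** X\<close>.\<close>
  moreover have "V ** (- ?A) ** transpose V = Q ** X"
  proof -
    have "I_sig k ** block_mat k zero_block B (transp_block B) zero_block = - ?A"
      by (simp add: I_sig_mult vec_eq_iff block_mat_def zero_block_def neg_block_def)
    then have "V ** (- ?A) ** transpose V = V ** I_sig k ** (transpose V ** V)
        ** block_mat k zero_block B (transp_block B) zero_block ** transpose V"
      by (simp add: V' flip: matrix_mul_assoc)
    then show ?thesis
      by (simp add: Q X matrix_mul_assoc)
  qed
  ultimately have \<gamma>_eq: "\<gamma> = (\<lambda>t. Q ** mexp (t *\<^sub>R (Q ** X)))"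
    by auto
  have geo: "geodesic_on (Gr k) UNIV \<gamma>"
    unfolding \<gamma>_eq by (rule geodesic_on_Gr_mult_mexp[OF Q_Gr X_tangent])
  moreover have "\<gamma> 0 = Q" "velocity \<gamma> 0 = X"
    by (simp_all add: \<gamma>_eq velocity_mult_mexp matrix_mul_assoc GrD[OF Q_Gr])
  moreover have "c t = \<gamma> t"
    if "geodesic_on (Gr k) J c" "0 \<in> J" "c 0 = Q" "velocity c 0 = X" "t \<in> J" for J c t
    using geodesic_on_Gr_eq[OF that(1,2,5)] that by (simp add: \<gamma>_eq)
  moreover have "\<forall>t. transpose (\<gamma> t) ** velocity (velocity \<gamma>) t
      - transpose (velocity (velocity \<gamma>) t) ** \<gamma> t = 0"
  proof -
    have "smooth_curve_on UNIV \<gamma>" "\<gamma> ` UNIV \<subseteq> Gr k"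
      using geo by (auto simp: geodesic_on_def)
    note iffD1[OF geodesic_on_Gr_iff_ode[OF open_UNIV is_interval_univ UNIV_I this(2)
          smooth_curve_onD[OF this(1)]] geo]
    then show ?thesis
      by blast
  qed
  moreover have "(geodesic_on (Gr k) J c \<and> c 0 = Q \<and> velocity c 0 = X) \<longleftrightarrow>
      ((\<forall>t\<in>J. transpose (c t) ** velocity (velocity c) t
          - transpose (velocity (velocity c) t) ** c t = 0) \<and> c 0 = Q \<and> velocity c 0 = X)"
    if "open J \<and> is_interval J \<and> 0 \<in> J \<and> c ` J \<subseteq> Gr k \<and>
        (\<forall>t\<in>J. c differentiable (at t)) \<and> (\<forall>t\<in>J. velocity c differentiable (at t))" for J c
    using that by (subst geodesic_on_Gr_iff_ode) blast+
  ultimately show ?thesis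
    by blast
qed

end
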